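(* Let $K=\mathbb Q(\sqrt d)$ be a quadratic field with $d\in\{-1,-2,-3,-7,-11\}$, and let $O_K$ be the ring of algebraic integers in $K$. Let $\pi$ be any irreducible element of $O_K$, and let $k$ be a positive integer with $\gcd(k,N(\pi)-1)>1$, where $N(\pi)=\pi\bar\pi$ is the norm of $\pi$ with respect to $K/\mathbb Q$. Then there exists a $k$th power non-residue $\omega\in O_K$ modulo $\pi$ with $|\omega|<\sqrt{|\pi|}+0.65$.
   Context: For $\alpha\in O_K$ not divisible by $\pi$, $\alpha$ is a $k$th power residue modulo $\pi$ if the congruence $x^k\equiv \alpha \pmod{\pi}$ has a solution $x\in O_K$, and a $k$th power non-residue modulo $\pi$ otherwise. Here $|\cdot|$ denotes the complex absolute value. *)

theory Defs
  imports Complex_Main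
    "HOL-Computational_Algebra.Polynomial"
    "HOL-Algebra.Ring_Divisibility"
begin

text \<open>
  The field $\mathbb{Q}(\sqrt{d})$ as a subset of the complex numbers; for $d < 0$,
  \<^term>\<open>csqrt (of_int d)\<close> is $i\sqrt{|d|}$.
\<close>
definition quad_field :: "int \<Rightarrow> complex set" where
  "quad_field d = {of_rat a + of_rat b * csqrt (of_int d) | a b. True}"

text \<open>
  The ring of all algebraic integers in $\mathbb{Q}(\sqrt{d})$, with the arithmetic of the complex
  numbers, packaged as a record so that units, divisibility and irreducibility are the library
  notions relative to this ring.
\<close>
definition quad_int_ring :: "int \<Rightarrow> complex ring" where
  "quad_int_ring d =
     \<lparr>carrier = {z \<in> quad_field d. algebraic_int z}, mult = (*), one = 1, zero = 0, add = (+)\<rparr>"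

text \<open>
  The norm to the rationals of an algebraic integer in an imaginary quadratic field. The nontrivial
  automorphism of such a field is complex conjugation, and the norm of an algebraic integer is a
  rational integer, so the description below is proper; it is used for $d < 0$ only.
\<close>
definition quad_norm :: "complex \<Rightarrow> int" where
  "quad_norm z = (THE n. of_int n = z * cnj z)"

definition quad_cong :: "int \<Rightarrow> complex \<Rightarrow> complex \<Rightarrow> complex \<Rightarrow> bool" where
  "quad_cong d p a b \<longleftrightarrow> p divides\<^bsub>quad_int_ring d\<^esub> (a - b)"

definition power_residue :: "int \<Rightarrow> nat \<Rightarrow> complex \<Rightarrow> complex \<Rightarrow> bool" where
  "power_residue d k p a \<longleftrightarrow>
     a \<in> carrier (quad_int_ring d) \<and> \<not> p divides\<^bsub>quad_int_ring d\<^esub> a \<and>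
     (\<exists>x \<in> carrier (quad_int_ring d). quad_cong d p (x ^ k) a)"

text \<open>
  Multiples of the modulus are neither residues nor non-residues.
\<close>
definition power_nonresidue :: "int \<Rightarrow> nat \<Rightarrow> complex \<Rightarrow> complex \<Rightarrow> bool" where
  "power_nonresidue d k p a \<longleftrightarrow>
     a \<in> carrier (quad_int_ring d) \<and> \<not> p divides\<^bsub>quad_int_ring d\<^esub> a \<and>
     \<not> power_residue d k p a"

end

theory Submission
  imports Defs
begin

text \<open>
  For these \<open>d\<close> every complex number lies at distance less than 1 from the ring of integers, which is
  therefore Euclidean for the norm. The residue field modulo \<open>\<pi>\<close> has \<open>N(\<pi>)\<close> elements and a cyclic
  multiplicative group, so a generator of it is not a \<open>k\<close>th power and non-residues exist. Let \<open>\<omega>\<close> be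
  one of least absolute value and divide: \<open>\<pi> = \<omega> q + r\<close> with \<open>|r| < |\<omega>|\<close>. Unless \<open>\<omega>\<close> is a unit, \<open>-r\<close>
  is a residue congruent to \<open>\<omega> q\<close>, so \<open>q\<close> is a non-residue, hence \<open>|\<omega>| \<le> |q|\<close> and
  \<open>|\<omega>|\<^sup>2 \<le> |\<pi> - r| < |\<pi>| + |\<omega>|\<close>.
\<close>

section \<open>Powers in the multiplicative group of a finite field\<close>

text \<open>The witness is a generator \<open>a\<close> of the cyclic group of units. If
  \<open>y [^] k = a\<close>, then \<open>a\<close> has order \<open>ord y / gcd (ord y) k\<close>.
  Since \<open>a\<close> has the largest possible order, \<open>y\<close> is a generator too and
  \<open>k\<close> is coprime to the group order.\<close>

lemma finite_field_power_not_surj: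
  fixes F (structure) and k :: nat
  assumes "field F" and fin: "finite (carrier F)" and k: "k > 0" "gcd k (order F - 1) > 1"
  shows "\<exists>c \<in> carrier F - {\<zero>}. \<forall>y \<in> carrier F. y [^] k \<noteq> c"
proof -
  interpret field F by fact
  let ?G = "Multiplicative_Group.mult_of F"
  note [simp] = Multiplicative_Group.mult_of_simps
  interpret G: group ?G
    rewrites "([^]\<^bsub>?G\<^esub>) = (([^]) :: _ \<Rightarrow> nat \<Rightarrow> _)" and "\<one>\<^bsub>?G\<^esub> = \<one>"
    by (rule field_mult_group) (simp_all add: fun_eq_iff nat_pow_def)
  have finG: "finite (carrier ?G)"
    using fin by simp
  obtain a where a: "a \<in> carrier ?G" "carrier ?G = {a [^] i | i :: nat. i \<in> UNIV}"
    using finite_field_mult_group_has_gen[OF fin] by auto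
  have order_G: "order ?G = order F - 1"
    using fin by (simp add: order_def card_Diff_singleton)
  have le: "G.ord y \<le> order F - 1" if "y \<in> carrier ?G" for y
    using G.ord_le_group_order[OF finG that] order_G by simp
  \<comment> \<open>The exponents \<open>0..ord a - 1\<close> number exactly \<open>ord a\<close>,
    because the order is at least 1. They exhaust the group, which bounds \<open>ord a\<close> from
    below.\<close>
  have "carrier ?G = {a [^] i | i :: nat. i \<in> {0..G.ord a - 1}}"
    using a(2) G.ord_elems[OF finG a(1)] by simp
  also have "\<dots> = (\<lambda>i::nat. a [^] i) ` {0..G.ord a - 1}"
    by auto
  finally have "order ?G \<le> card {0..G.ord a - 1}"
    unfolding order_def by (metis card_image_le finite_atLeastAtMost)
  then have ord_a: "order F - 1 \<le> G.ord a"
    using order_G G.ord_ge_1[OF finG a(1)] by simp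
  have "y [^] k \<noteq> a" if y: "y \<in> carrier F" for y
  proof
    assume ya: "y [^] k = a"
    have "y \<noteq> \<zero>"
      using ya a(1) k(1) by (auto simp: nat_pow_zero)
    then have yG: "y \<in> carrier ?G"
      using y by simp
    have "G.ord a = G.ord y div gcd (G.ord y) k"
      using G.ord_pow_gen[OF yG, of k] ya k(1) by simp
    then have "order F - 1 \<le> G.ord y div gcd (G.ord y) k"
      using ord_a by simp
    moreover have pos: "0 < G.ord y"
      using G.ord_ge_1[OF finG yG] by simp
    moreover have "gcd (G.ord y) k > 0"
      using k(1) by simp
    \<comment> \<open>A larger gcd would push the quotient strictly below \<open>ord y\<close>,
      hence below the group order.\<close>
    ultimately have "gcd (G.ord y) k = 1"
      using le[OF yG] div_less_dividend[of "gcd (G.ord y) k" "G.ord y"] by linarith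
    moreover have "G.ord y = order F - 1"
      using \<open>order F - 1 \<le> G.ord y div gcd (G.ord y) k\<close> le[OF yG] calculation by simp
    ultimately show False
      using k(2) by (simp add: gcd.commute)
  qed
  then show ?thesis
    using a(1) by auto
qed

section \<open>The lattice spanned by 1 and \<open>\<theta>\<close>\<close>

text \<open>\<open>t\<close> and \<open>n\<close> are the trace and norm of \<open>\<theta>\<close>.
  The bound 3 is what puts every complex number at distance less than 1 from the lattice:
  \<open>1/4 + (Im \<theta>)^2 / 4 < 1\<close>.\<close>

locale euclidean_quad =
  fixes d :: int and \<theta> :: complex and t n :: int
  assumes Re_theta: "2 * Re \<theta> = of_int t"
    and cmod_theta: "(cmod \<theta>)\<^sup>2 = of_int n"
    and Im_theta: "Im \<theta> \<noteq> 0"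
    and Im_theta_less: "(Im \<theta>)\<^sup>2 < 3"
    and theta_field: "\<theta> \<in> quad_field d"
    and csqrt_eq: "\<exists>a b :: int. csqrt (of_int d) = of_int a + of_int b * \<theta>"
begin

text \<open>The explicit order Z[\<open>\<theta>\<close>], identified with the ring of all integers
  of the field in \<open>carrier_eq\<close>.\<close>

definition \<O> :: "complex set" where
  "\<O> = {of_int a + of_int b * \<theta> | a b :: int. True}"

lemma ordI: "of_int a + of_int b * \<theta> \<in> \<O>"
  by (auto simp: \<O>_def)

lemma of_int_ord [simp]: "of_int a \<in> \<O>"
  using ordI[of a 0] by simp

lemma zero_ord [simp]: "0 \<in> \<O>" and one_ord [simp]: "1 \<in> \<O>"
  using of_int_ord[of 0] of_int_ord[of 1] by simp_all

lemma of_nat_ord [simp]: "of_nat a \<in> \<O>"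
  using of_int_ord[of "int a"] by simp

lemma cnj_theta: "cnj \<theta> = of_int t - \<theta>"
  using Re_theta by (simp add: complex_eq_iff)

lemma theta_square: "\<theta> * \<theta> = of_int t * \<theta> - of_int n"
proof -
  have "\<theta> * cnj \<theta> = of_int n"
    using cmod_theta by (simp add: complex_norm_square[symmetric] del: of_real_power)
  then show ?thesis
    unfolding cnj_theta by (simp add: algebra_simps)
qed

lemma add_ord [intro, simp]:
  assumes "x \<in> \<O>" "y \<in> \<O>"
  shows "x + y \<in> \<O>"
proof -
  obtain a b a' b' :: int
    where "x = of_int a + of_int b * \<theta>" "y = of_int a' + of_int b' * \<theta>"
    using assms by (auto simp: \<O>_def)
  then have "x + y = of_int (a + a') + of_int (b + b') * \<theta>"
    by (simp add: algebra_simps)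
  then show ?thesis
    using ordI by metis
qed

lemma mult_ord [intro, simp]:
  assumes "x \<in> \<O>" "y \<in> \<O>"
  shows "x * y \<in> \<O>"
proof -
  obtain a b a' b' :: int
    where xy: "x = of_int a + of_int b * \<theta>" "y = of_int a' + of_int b' * \<theta>"
    using assms by (auto simp: \<O>_def)
  have "x * y = of_int (a * a') + of_int (a * b' + b * a') * \<theta> + of_int (b * b') * (\<theta> * \<theta>)"
    by (simp add: xy algebra_simps)
  also have "\<dots> = of_int (a * a' - b * b' * n) + of_int (a * b' + b * a' + b * b' * t) * \<theta>"
    unfolding theta_square by (simp add: algebra_simps)
  finally show ?thesis
    using ordI by metis
qed

lemma minus_ord [intro, simp]: "x \<in> \<O> \<Longrightarrow> - x \<in> \<O>"
  using mult_ord[of "of_int (-1)" x] of_int_ord[of "-1"] by simp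

lemma diff_ord [intro, simp]: "x \<in> \<O> \<Longrightarrow> y \<in> \<O> \<Longrightarrow> x - y \<in> \<O>"
  using add_ord[of x "- y"] by simp

lemma power_ord [intro, simp]: "x \<in> \<O> \<Longrightarrow> x ^ k \<in> \<O>"
  by (induction k) auto

lemma sum_ord [intro]: "(\<And>i. i \<in> A \<Longrightarrow> f i \<in> \<O>) \<Longrightarrow> sum f A \<in> \<O>"
  by (induction A rule: infinite_finite_induct) auto

lemma cnj_ord [intro, simp]: "x \<in> \<O> \<Longrightarrow> cnj x \<in> \<O>"
proof -
  assume "x \<in> \<O>"
  then obtain a b :: int where x: "x = of_int a + of_int b * \<theta>"
    by (auto simp: \<O>_def)
  have "cnj x = of_int (a + b * t) + of_int (-b) * \<theta>"
    by (simp add: x cnj_theta algebra_simps)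
  then show ?thesis
    using ordI by metis
qed

text \<open>In coordinates the squared modulus is the integral form
  \<open>a^2 + a b t + b^2 n\<close>. This discreteness is behind the vanishing of elements of
  modulus below 1 and the choice of a least non-residue.\<close>

lemma norm_ord:
  assumes "x \<in> \<O>"
  obtains k :: nat where "(cmod x)\<^sup>2 = of_nat k"
proof -
  obtain a b :: int where x: "x = of_int a + of_int b * \<theta>"
    using assms by (auto simp: \<O>_def)
  have "(cmod x)\<^sup>2 = (Re x)\<^sup>2 + (Im x)\<^sup>2"
    by (rule cmod_power2)
  also have "\<dots> = a\<^sup>2 + a * b * (2 * Re \<theta>) + b\<^sup>2 * ((Re \<theta>)\<^sup>2 + (Im \<theta>)\<^sup>2)"
    by (simp add: x power2_eq_square algebra_simps)
  also have "\<dots> = of_int (a\<^sup>2 + a * b * t + b\<^sup>2 * n)"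
    using cmod_theta by (simp add: Re_theta cmod_power2)
  finally have eq: "(cmod x)\<^sup>2 = of_int (a\<^sup>2 + a * b * t + b\<^sup>2 * n)" .
  then have "0 \<le> a\<^sup>2 + a * b * t + b\<^sup>2 * n"
    by (metis of_int_0_le_iff zero_le_power2)
  then show ?thesis
    using eq that[of "nat (a\<^sup>2 + a * b * t + b\<^sup>2 * n)"] by simp
qed

lemma ord_zero_if_cmod_less_1:
  assumes "x \<in> \<O>" "cmod x < 1"
  shows "x = 0"
proof -
  obtain k :: nat where k: "(cmod x)\<^sup>2 = of_nat k"
    using norm_ord[OF assms(1)] .
  have "(cmod x)\<^sup>2 < 1"
    using assms(2) by (simp add: power_less_one_iff)
  then show ?thesis
    using k by simp
qed

text \<open>The coefficient of \<open>\<theta>\<close> is rounded first, to match the imaginary part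
  up to \<open>|Im \<theta>| / 2\<close>. The integer coefficient then corrects the real part up to
  1/2, taking \<open>Re \<theta>\<close> into account.\<close>

lemma ord_approx: "\<exists>q\<in>\<O>. cmod (z - q) < 1"
proof -
  define b where "b = round (Im z / Im \<theta>)"
  define a where "a = round (Re z - b * Re \<theta>)"
  define w where "w = z - (of_int a + of_int b * \<theta>)"
  have "\<bar>Re w\<bar> \<le> 1/2"
    using of_int_round_abs_le[of "Re z - b * Re \<theta>"] by (simp add: w_def a_def abs_minus_commute diff_diff_eq2 algebra_simps)
  then have "(Re w)\<^sup>2 \<le> (1/2)\<^sup>2"
    using abs_le_square_iff[of "Re w" "1/2"] by simp
  moreover have "\<bar>Im w\<bar> \<le> \<bar>Im \<theta> / 2\<bar>"
  proof -
    have "Im w = (Im z / Im \<theta> - b) * Im \<theta>"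
      using Im_theta by (simp add: w_def field_simps)
    then have "\<bar>Im w\<bar> = \<bar>b - Im z / Im \<theta>\<bar> * \<bar>Im \<theta>\<bar>"
      by (simp add: abs_mult abs_minus_commute)
    also have "\<dots> \<le> 1/2 * \<bar>Im \<theta>\<bar>"
      unfolding b_def by (intro mult_right_mono of_int_round_abs_le) simp
    finally show ?thesis by simp
  qed
  then have "(Im w)\<^sup>2 \<le> (Im \<theta> / 2)\<^sup>2"
    using abs_le_square_iff by blast
  ultimately have "(cmod w)\<^sup>2 < 1"
    using Im_theta_less unfolding cmod_power2 by (simp add: power_divide)
  then have "cmod w < 1"
    by (simp add: power_less_one_iff)
  then show ?thesis
    unfolding w_def using ordI by blast
qed

subsection \<open>The ring of integers\<close>

lemma ord_subset_field:
  assumes "x \<in> \<O>"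
  shows "x \<in> quad_field d"
proof -
  obtain a b :: int where x: "x = of_int a + of_int b * \<theta>"
    using assms by (auto simp: \<O>_def)
  obtain p q where th: "\<theta> = of_rat p + of_rat q * csqrt (of_int d)"
    using theta_field by (auto simp: quad_field_def)
  have "x = of_rat (of_int a + of_int b * p) + of_rat (of_int b * q) * csqrt (of_int d)"
    by (simp add: x th of_rat_add of_rat_mult algebra_simps)
  then show ?thesis
    unfolding quad_field_def by blast
qed

text \<open>\<open>x\<close> is a root of X^2 - (x + cnj x) X + x cnj x, whose coefficients are its
  integral trace and norm.\<close>

lemma ord_algebraic_int:
  assumes "x \<in> \<O>"
  shows "algebraic_int x"
proof -
  obtain a b :: int where x: "x = of_int a + of_int b * \<theta>"
    using assms by (auto simp: \<O>_def)
  obtain k :: nat where k: "(cmod x)\<^sup>2 = of_nat k"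
    using norm_ord[OF assms] .
  have "x + cnj x = of_int (2 * a + b * t)"
    by (simp add: x cnj_theta algebra_simps)
  moreover have "x * cnj x = of_nat k"
    using k by (simp add: complex_norm_square[symmetric] del: of_real_power)
  moreover have "poly [:x * cnj x, - (x + cnj x), 1:] x = 0"
    by (simp add: algebra_simps)
  ultimately have 0: "poly [:of_nat k, - of_int (2 * a + b * t), 1:] x = 0"
    by simp
  show ?thesis
    by (rule algebraic_int.intros[OF _ _ 0])
      (auto simp: coeff_pCons simp del: of_int_add of_int_mult split: nat.split)
qed

lemma field_denominator:
  assumes "z \<in> quad_field d"
  obtains e :: int where "e > 0" "of_int e * z \<in> \<O>"
proof -
  obtain p q where z: "z = of_rat p + of_rat q * csqrt (of_int d)"
    using assms by (auto simp: quad_field_def)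
  obtain a b where p: "p = of_int a / of_int b" "b > 0"
    by (metis Fract_of_int_quotient Rat_cases)
  obtain a' b' where q: "q = of_int a' / of_int b'" "b' > 0"
    by (metis Fract_of_int_quotient Rat_cases)
  have s: "csqrt (of_int d) \<in> \<O>"
    using csqrt_eq ordI by metis
  have "of_int (b * b') * z = of_int (b' * a) + of_int (b * a') * csqrt (of_int d)"
  proof -
    have "of_int b * of_rat p = (of_int a :: complex)" "of_int b' * of_rat q = (of_int a' :: complex)"
      using p q by (simp_all add: of_rat_divide)
    then show ?thesis
      unfolding z of_int_mult ring_distribs by (metis (no_types) mult.assoc mult.commute)
  qed
  also have "\<dots> \<in> \<O>"
    using s by (intro add_ord mult_ord of_int_ord)
  finally show ?thesis
    using that[of "b * b'"] p(2) q(2) by simp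
qed

text \<open>One denominator serves all powers. If \<open>e\<close> clears \<open>z\<close> and
  \<open>m\<close> is the degree of a monic integral equation of \<open>z\<close>, then
  \<open>e ^ m\<close> clears the powers below \<open>m\<close>, and the equation reduces every
  higher power to integral combinations of lower ones.\<close>

lemma bounded_denominators:
  assumes "z \<in> quad_field d" "algebraic_int z"
  obtains D :: int where "D > 0" "\<And>k. of_int D * z ^ k \<in> \<O>"
proof -
  obtain e :: int where e: "e > 0" "of_int e * z \<in> \<O>"
    using field_denominator[OF assms(1)] .
  obtain p where p: "poly p z = 0" "lead_coeff p = 1" "\<And>i. Polynomial.coeff p i \<in> \<int>"
    using assms(2) by (auto elim: algebraic_int.cases)
  define m where "m = degree p"
  define D where "D = e ^ m"
  have "of_int D * z ^ k \<in> \<O>" for k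
  proof (induction k rule: less_induct)
    case (less k)
    show ?case
    proof (cases "k < m")
      case True
      then have "of_int D * z ^ k = of_int (e ^ (m - k)) * (of_int e * z) ^ k"
        by (simp add: D_def power_mult_distrib mult.assoc[symmetric] power_add[symmetric])
      then show ?thesis
        using e(2) by (metis mult_ord of_int_ord power_ord)
    next
      case False
      have "0 = (\<Sum>i\<le>m. Polynomial.coeff p i * z ^ i)"
        using p(1) by (simp add: poly_altdef m_def)
      also have "\<dots> = (\<Sum>i<m. Polynomial.coeff p i * z ^ i) + z ^ m"
        using p(2) by (simp add: m_def lessThan_Suc_atMost[symmetric])
      finally have "z ^ m = - (\<Sum>i<m. Polynomial.coeff p i * z ^ i)"
        by (simp add: eq_neg_iff_add_eq_0 add.commute)
      moreover have "z ^ k = z ^ m * z ^ (k - m)"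
        using False by (simp add: power_add[symmetric])
      ultimately have "z ^ k = - (\<Sum>i<m. Polynomial.coeff p i * z ^ i) * z ^ (k - m)"
        by simp
      then have "of_int D * z ^ k = - (\<Sum>i<m. Polynomial.coeff p i * (of_int D * z ^ (k - m + i)))"
        by (simp add: sum_distrib_left sum_distrib_right power_add mult_ac)
      also have "\<dots> \<in> \<O>"
      proof (intro minus_ord sum_ord)
        fix i assume i: "i \<in> {..<m}"
        have "Polynomial.coeff p i \<in> \<O>"
          using p(3)[of i] by (auto elim: Ints_cases)
        moreover have "of_int D * z ^ (k - m + i) \<in> \<O>"
          using i False by (intro less.IH) simp
        ultimately show "Polynomial.coeff p i * (of_int D * z ^ (k - m + i)) \<in> \<O>"
          by blast
      qed
      finally show ?thesis .
    qed
  qed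
  moreover have "D > 0"
    using e by (simp add: D_def)
  ultimately show ?thesis
    using that by blast
qed

text \<open>
  If \<open>z\<close> is an integer of the field and \<open>q\<close> is an element of the order at distance less than 1
  from it, the powers of \<open>z - q\<close> tend to 0 but have bounded denominators, so \<open>z = q\<close>.
\<close>
lemma carrier_eq: "carrier (quad_int_ring d) = \<O>"
proof -
  have "z \<in> \<O>" if z: "z \<in> quad_field d" "algebraic_int z" for z
  proof -
    obtain D :: int where D: "D > 0" "\<And>k. of_int D * z ^ k \<in> \<O>"
      using bounded_denominators[OF z] by metis
    obtain q where q: "q \<in> \<O>" "cmod (z - q) < 1"
      using ord_approx by blast
    \<comment> \<open>Only the powers of \<open>z\<close> need a denominator in the binomial
      expansion, as \<open>q\<close> lies in the order.\<close>
    have "of_int D * (z - q) ^ k \<in> \<O>" for k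
    proof -
      have "of_int D * (z - q) ^ k
          = (\<Sum>i\<le>k. of_nat (k choose i) * (of_int D * z ^ i) * (- q) ^ (k - i))"
        using binomial_ring[of z "- q" k] by (simp add: sum_distrib_left mult_ac)
      also have "\<dots> \<in> \<O>"
        using D(2) q(1) by (intro sum_ord mult_ord[OF mult_ord] of_nat_ord power_ord minus_ord)
      finally show ?thesis .
    qed
    moreover have "(\<lambda>k. of_int D * cmod (z - q) ^ k) \<longlonglongrightarrow> of_int D * 0"
      using q(2) by (intro tendsto_intros LIMSEQ_power_zero) simp
    then have "eventually (\<lambda>k. of_int D * cmod (z - q) ^ k < 1) sequentially"
      by (auto dest: order_tendstoD(2)[of _ _ _ 1])
    then obtain k where "D * cmod (z - q) ^ k < 1"
      by (auto simp: eventually_sequentially)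
    then have "cmod (of_int D * (z - q) ^ k) < 1"
      using D(1) by (simp add: norm_mult norm_power)
    ultimately have "of_int D * (z - q) ^ k = 0"
      using ord_zero_if_cmod_less_1 by blast
    then show ?thesis
      using D(1) q(1) by simp
  qed
  then show ?thesis
    using ord_subset_field ord_algebraic_int by (auto simp: quad_int_ring_def)
qed

subsection \<open>The number of residue classes\<close>

definition residue_class :: "complex \<Rightarrow> complex \<Rightarrow> complex set" where
  "residue_class m x = {x + m * y | y. y \<in> \<O>}"

lemma residue_class_eq_iff:
  assumes "m \<in> \<O>"
  shows "residue_class m x = residue_class m x' \<longleftrightarrow> (\<exists>y\<in>\<O>. x = x' + m * y)"
proof
  assume "residue_class m x = residue_class m x'"
  moreover have "x \<in> residue_class m x"
    using zero_ord by (force simp: residue_class_def)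
  ultimately show "\<exists>y\<in>\<O>. x = x' + m * y"
    by (auto simp: residue_class_def)
next
  assume "\<exists>y\<in>\<O>. x = x' + m * y"
  then obtain y where y: "y \<in> \<O>" "x = x' + m * y" by blast
  have "x + m * z = x' + m * (y + z)" "x' + m * z = x + m * (z - y)" for z
    using y by (simp_all add: algebra_simps)
  then show "residue_class m x = residue_class m x'"
    using y(1) unfolding residue_class_def by (blast intro: add_ord diff_ord)
qed

text \<open>The index of the ideal generated by \<open>m\<close>. Since \<open>card\<close> is 0 on
  infinite sets, a positive value also yields finiteness.\<close>

definition index :: "complex \<Rightarrow> nat" where
  "index m = card (residue_class m ` \<O>)"

lemma residue_system:
  obtains R where "R \<subseteq> \<O>" "bij_betw (residue_class m) R (residue_class m ` \<O>)"
  using subset_image_inj[of "residue_class m ` \<O>" "residue_class m" \<O>]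
  unfolding bij_betw_def by (metis subset_refl)

text \<open>A two-digit expansion: modulo \<open>a * b\<close> every element is
  \<open>r + a * s\<close> for exactly one representative \<open>r\<close> modulo \<open>a\<close>
  and one representative \<open>s\<close> modulo \<open>b\<close>.\<close>

lemma index_mult:
  assumes "a \<in> \<O>" "a \<noteq> 0" "b \<in> \<O>"
  shows "index (a * b) = index a * index b"
proof -
  obtain R where R: "R \<subseteq> \<O>" "bij_betw (residue_class a) R (residue_class a ` \<O>)"
    by (rule residue_system)
  obtain S where S: "S \<subseteq> \<O>" "bij_betw (residue_class b) S (residue_class b ` \<O>)"
    by (rule residue_system)
  let ?f = "\<lambda>(r, s). residue_class (a * b) (r + a * s)"
  have "inj_on ?f (R \<times> S)"
  proof (rule inj_onI, clarify)
    fix r s r' s'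
    assume rs: "r \<in> R" "s \<in> S" "r' \<in> R" "s' \<in> S"
      and "residue_class (a * b) (r + a * s) = residue_class (a * b) (r' + a * s')"
    then obtain y where y: "y \<in> \<O>" "r + a * s = r' + a * s' + a * b * y"
      using assms residue_class_eq_iff mult_ord by metis
    have "r = r' + a * (s' - s + b * y)"
      using y(2) by (simp add: algebra_simps)
    moreover have "s' - s + b * y \<in> \<O>"
      using rs S(1) y(1) assms(3) by blast
    ultimately have "residue_class a r = residue_class a r'"
      using residue_class_eq_iff[OF assms(1)] by blast
    then have r: "r = r'"
      using R(2) rs by (auto simp: bij_betw_def dest: inj_onD)
    then have "a * s = a * (s' + b * y)"
      using y(2) by (simp add: algebra_simps)
    then have "s = s' + b * y"
      using assms(2) by simp
    then have "residue_class b s = residue_class b s'"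
      using residue_class_eq_iff[OF assms(3)] y(1) by blast
    then have "s = s'"
      using S(2) rs by (auto simp: bij_betw_def dest: inj_onD)
    with r show "r = r' \<and> s = s'" ..
  qed
  moreover have "?f ` (R \<times> S) = residue_class (a * b) ` \<O>"
  proof (intro equalityI subsetI)
    fix c assume "c \<in> residue_class (a * b) ` \<O>"
    then obtain x where x: "x \<in> \<O>" "c = residue_class (a * b) x" by blast
    obtain r where r: "r \<in> R" "residue_class a x = residue_class a r"
      using R(2) x(1) by (metis bij_betw_imp_surj_on image_iff imageI)
    then obtain y where y: "y \<in> \<O>" "x = r + a * y"
      using residue_class_eq_iff[OF assms(1)] by blast
    obtain s where s: "s \<in> S" "residue_class b y = residue_class b s"
      using S(2) y(1) by (metis bij_betw_imp_surj_on image_iff imageI)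
    then obtain z where z: "z \<in> \<O>" "y = s + b * z"
      using residue_class_eq_iff[OF assms(3)] by blast
    have "x = (r + a * s) + a * b * z"
      using y z by (simp add: algebra_simps)
    then have "c = ?f (r, s)"
      using x(2) z(1) residue_class_eq_iff[of "a * b"] assms mult_ord by auto
    then show "c \<in> ?f ` (R \<times> S)"
      using r(1) s(1) by blast
  next
    fix c assume "c \<in> ?f ` (R \<times> S)"
    then obtain r s where "r \<in> R" "s \<in> S" "c = residue_class (a * b) (r + a * s)"
      by auto
    then show "c \<in> residue_class (a * b) ` \<O>"
      using R(1) S(1) assms(1) by (blast intro: add_ord mult_ord)
  qed
  ultimately have "card (R \<times> S) = index (a * b)"
    unfolding index_def by (metis card_image)
  then show ?thesis
    using R(2) S(2) unfolding index_def
    by (simp add: card_cartesian_product bij_betw_same_card)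
qed

text \<open>Conjugation is an automorphism of the order and carries the cosets of \<open>m\<close>
  onto those of \<open>cnj m\<close>.\<close>

lemma index_cnj: "index (cnj m) = index m"
proof -
  have cnj_surj: "cnj ` \<O> = \<O>"
    by (metis cnj_ord complex_cnj_cnj image_iff image_subsetI subsetI subset_antisym)
  have "residue_class (cnj m) (cnj x) = cnj ` residue_class m x" for x
  proof -
    have "residue_class (cnj m) (cnj x) = (\<lambda>y. cnj x + cnj m * y) ` cnj ` \<O>"
      unfolding cnj_surj by (auto simp: residue_class_def)
    also have "\<dots> = cnj ` residue_class m x"
      by (auto simp: residue_class_def image_image setcompr_eq_image)
    finally show ?thesis .
  qed
  then have "residue_class (cnj m) ` cnj ` \<O> = image cnj ` residue_class m ` \<O>"
    by (simp add: image_image)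
  then have "residue_class (cnj m) ` \<O> = image cnj ` residue_class m ` \<O>"
    by (simp add: cnj_surj)
  moreover have "inj (image cnj)"
    by (simp add: inj_def inj_image_eq_iff)
  ultimately show ?thesis
    unfolding index_def by (metis card_image inj_on_subset subset_UNIV)
qed

text \<open>Coordinates with respect to the basis 1, \<open>\<theta>\<close> can be reduced modulo
  \<open>N\<close> independently of each other.\<close>

lemma index_of_nat:
  assumes "N > 0"
  shows "index (of_nat N) = N * N"
proof -
  let ?f = "\<lambda>(a, b). residue_class (of_nat N) (of_int a + of_int b * \<theta>)"
  let ?I = "{0..<int N}"
  have "inj_on ?f (?I \<times> ?I)"
  proof (rule inj_onI, clarify)
    fix a b a' b' :: int
    assume ab: "a \<in> ?I" "b \<in> ?I" "a' \<in> ?I" "b' \<in> ?I"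
      and "residue_class (of_nat N) (of_int a + of_int b * \<theta>)
         = residue_class (of_nat N) (of_int a' + of_int b' * \<theta>)"
    then obtain y where y: "y \<in> \<O>"
      "of_int a + of_int b * \<theta> = of_int a' + of_int b' * \<theta> + of_nat N * y"
      using residue_class_eq_iff of_nat_ord by blast
    then obtain u v :: int where uv: "y = of_int u + of_int v * \<theta>"
      by (auto simp: \<O>_def)
    \<comment> \<open>Imaginary parts determine \<open>b\<close>, since \<open>Im \<theta>\<close>
      is nonzero. Once \<open>b = b'\<close> and \<open>v = 0\<close>, real parts determine
      \<open>a\<close>.\<close>
    have "b * Im \<theta> = (b' + N * v) * Im \<theta>"
      using arg_cong[OF y(2), of Im] by (simp add: uv algebra_simps)
    then have "real_of_int b = of_int (b' + int N * v)"
      using Im_theta by simp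
    then have b: "b = b' + int N * v"
      by linarith
    then have "b = b'"
      using ab by (metis atLeastLessThan_iff mod_mult_self2 mod_pos_pos_trivial)
    then have "v = 0"
      using b assms by simp
    then have "real_of_int a = of_int (a' + int N * u)"
      using arg_cong[OF y(2), of Re] \<open>b = b'\<close> by (simp add: uv)
    then have "a = a' + int N * u"
      by linarith
    then have "a = a'"
      using ab by (metis atLeastLessThan_iff mod_mult_self2 mod_pos_pos_trivial)
    with \<open>b = b'\<close> show "a = a' \<and> b = b'" by simp
  qed
  moreover have "?f ` (?I \<times> ?I) = residue_class (of_nat N) ` \<O>"
  proof (intro equalityI subsetI)
    fix c assume "c \<in> residue_class (of_nat N) ` \<O>"
    then obtain a b :: int where c: "c = residue_class (of_nat N) (of_int a + of_int b * \<theta>)"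
      by (auto simp: \<O>_def)
    have "(of_int a + of_int b * \<theta> :: complex)
        = of_int (a mod int N + int N * (a div int N))
          + of_int (b mod int N + int N * (b div int N)) * \<theta>"
      by simp
    also have "\<dots> = (of_int (a mod int N) + of_int (b mod int N) * \<theta>)
          + of_nat N * (of_int (a div int N) + of_int (b div int N) * \<theta>)"
      unfolding of_int_add of_int_mult by (simp add: algebra_simps)
    finally have "c = ?f (a mod int N, b mod int N)"
      using residue_class_eq_iff[OF of_nat_ord] ordI unfolding c by auto
    then show "c \<in> ?f ` (?I \<times> ?I)"
      using assms by (intro image_eqI) auto
  qed (auto intro: ordI)
  ultimately have "card (?I \<times> ?I) = index (of_nat N)"
    unfolding index_def by (metis card_image)
  then show ?thesis
    by (simp add: card_cartesian_product)
qed

text \<open>The indices of \<open>m\<close> and \<open>cnj m\<close> agree and their product is the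
  index of \<open>N\<close>, which is \<open>N * N\<close>.\<close>

lemma index_eq_norm:
  assumes "m \<in> \<O>" "m \<noteq> 0" "(cmod m)\<^sup>2 = of_nat N"
  shows "index m = N"
proof -
  have "m * cnj m = of_nat N"
    using assms(3) by (simp add: complex_norm_square[symmetric] del: of_real_power)
  moreover have "N > 0"
    using assms(2,3) by (auto intro: gr0I)
  ultimately have "index m * index m = N * N"
    using index_mult[of m "cnj m"] index_of_nat assms(1,2) by (simp add: index_cnj)
  then show ?thesis
    by (metis power2_eq_iff_nonneg power2_eq_square zero_le)
qed

section \<open>The Euclidean domain structure\<close>

lemma ring_simps [simp]:
  "carrier (quad_int_ring d) = \<O>"
  "mult (quad_int_ring d) = (*)" "one (quad_int_ring d) = 1"
  "zero (quad_int_ring d) = 0" "add (quad_int_ring d) = (+)"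
  by (simp_all add: carrier_eq) (simp_all add: quad_int_ring_def)

lemma pow_eq [simp]: "x [^]\<^bsub>quad_int_ring d\<^esub> (k :: nat) = x ^ k"
  by (induction k) (simp_all add: nat_pow_def mult.commute)

lemma divides_iff: "m divides\<^bsub>quad_int_ring d\<^esub> x \<longleftrightarrow> (\<exists>y\<in>\<O>. x = m * y)"
  by (auto simp: factor_def)

lemma ord_division:
  assumes "b \<noteq> 0" "a \<in> \<O>" "b \<in> \<O>"
  obtains q r where "q \<in> \<O>" "r \<in> \<O>" "a = b * q + r" "cmod r < cmod b"
proof -
  obtain q where q: "q \<in> \<O>" "cmod (a / b - q) < 1"
    using ord_approx by blast
  have "cmod (a - b * q) = cmod b * cmod (a / b - q)"
    unfolding norm_mult[symmetric] using assms(1) by (simp add: right_diff_distrib)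
  also have "\<dots> < cmod b * 1"
    using assms(1) q(2) by (intro mult_strict_left_mono) simp_all
  finally show ?thesis
    using that[of q "a - b * q"] q(1) assms by simp
qed

text \<open>The size function has to take natural values. The squared modulus is already a natural
  number, so the floor loses nothing.\<close>

lemma norm_less:
  assumes "x \<in> \<O>" "y \<in> \<O>" "cmod x < cmod y"
  shows "nat \<lfloor>(cmod x)\<^sup>2\<rfloor> < nat \<lfloor>(cmod y)\<^sup>2\<rfloor>"
proof -
  obtain j k :: nat where jk: "(cmod x)\<^sup>2 = of_nat j" "(cmod y)\<^sup>2 = of_nat k"
    using norm_ord assms(1,2) by metis
  have "(cmod x)\<^sup>2 < (cmod y)\<^sup>2"
    using assms(3) by (simp add: power_strict_mono)
  then show ?thesis
    by (simp add: jk)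
qed

text \<open>This makes the ring a principal ideal domain, in which an irreducible element generates
  a maximal ideal.\<close>

lemma euclidean: "euclidean_domain (quad_int_ring d) (\<lambda>z. nat \<lfloor>(cmod z)\<^sup>2\<rfloor>)"
proof -
  have cring: "cring (quad_int_ring d)"
  proof (intro cringI abelian_groupI comm_monoidI)
    fix x assume "x \<in> carrier (quad_int_ring d)"
    then show "\<exists>y\<in>carrier (quad_int_ring d). y \<oplus>\<^bsub>quad_int_ring d\<^esub> x = \<zero>\<^bsub>quad_int_ring d\<^esub>"
      by (intro bexI[of _ "- x"]) auto
  qed (auto simp: algebra_simps)
  interpret domain "quad_int_ring d"
    by (rule domain.intro[OF cring]) (unfold_locales, auto)
  show ?thesis
  proof (rule euclidean_domainI)
    fix a b
    assume "a \<in> carrier (quad_int_ring d) - {\<zero>\<^bsub>quad_int_ring d\<^esub>}"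
      and "b \<in> carrier (quad_int_ring d) - {\<zero>\<^bsub>quad_int_ring d\<^esub>}"
    then have ab: "a \<in> \<O>" "b \<in> \<O>" "b \<noteq> 0" by auto
    obtain q r where "q \<in> \<O>" "r \<in> \<O>" "a = b * q + r" "cmod r < cmod b"
      using ord_division[OF ab(3,1,2)] .
    then show "\<exists>q r. q \<in> carrier (quad_int_ring d) \<and> r \<in> carrier (quad_int_ring d) \<and>
        a = b \<otimes>\<^bsub>quad_int_ring d\<^esub> q \<oplus>\<^bsub>quad_int_ring d\<^esub> r \<and>
        (r = \<zero>\<^bsub>quad_int_ring d\<^esub> \<or> nat \<lfloor>(cmod r)\<^sup>2\<rfloor> < nat \<lfloor>(cmod b)\<^sup>2\<rfloor>)"
      using norm_less ab(2) by auto
  qed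
qed

sublocale O: euclidean_domain "quad_int_ring d" "\<lambda>z. nat \<lfloor>(cmod z)\<^sup>2\<rfloor>"
  by (rule euclidean)

end

section \<open>The residue field modulo an irreducible element\<close>

locale euclidean_quad_prime = euclidean_quad +
  fixes \<pi> :: complex
  assumes pi_ord: "\<pi> \<in> \<O>"
    and pi_irreducible: "ring_irreducible\<^bsub>quad_int_ring d\<^esub> \<pi>"
begin

definition residue_field :: "complex set ring" where
  "residue_field = quad_int_ring d Quot PIdl\<^bsub>quad_int_ring d\<^esub> \<pi>"

lemma pi_nonzero: "\<pi> \<noteq> 0"
  using pi_irreducible by (simp add: ring_irreducible_def)

lemma pi_maximal: "maximalideal (PIdl\<^bsub>quad_int_ring d\<^esub> \<pi>) (quad_int_ring d)"
  using O.irreducible_imp_maximalideal pi_ord pi_irreducible by simp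

sublocale F: field residue_field
  unfolding residue_field_def
  using maximalideal.quotient_is_field[OF pi_maximal O.is_cring] .

text \<open>Identifies the elements of the quotient ring with the classes counted by
  \<open>index\<close>, so that the residue field has as many elements as the norm of
  \<open>\<pi>\<close>.\<close>

lemma coset_eq:
  "PIdl\<^bsub>quad_int_ring d\<^esub> \<pi> +>\<^bsub>quad_int_ring d\<^esub> x = residue_class \<pi> x"
  by (auto simp: a_r_coset_def' cgenideal_def residue_class_def add.commute mult.commute)

lemma carrier_residue_field: "carrier residue_field = residue_class \<pi> ` \<O>"
  by (auto simp: residue_field_def FactRing_def A_RCOSETS_def' coset_eq)

sublocale h: ring_hom_ring "quad_int_ring d" residue_field "residue_class \<pi>"
proof -
  interpret I: maximalideal "PIdl\<^bsub>quad_int_ring d\<^esub> \<pi>" "quad_int_ring d"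
    by (rule pi_maximal)
  show "ring_hom_ring (quad_int_ring d) residue_field (residue_class \<pi>)"
    using I.rcos_ring_hom_ring unfolding residue_field_def coset_eq[abs_def] .
qed

lemma residue_class_eq:
  "x \<in> \<O> \<Longrightarrow> y \<in> \<O> \<Longrightarrow>
    residue_class \<pi> x = residue_class \<pi> y \<longleftrightarrow> \<pi> divides\<^bsub>quad_int_ring d\<^esub> (x - y)"
  unfolding residue_class_eq_iff[OF pi_ord] divides_iff by (auto simp: algebra_simps)

lemma residue_class_eq_zero:
  "x \<in> \<O> \<Longrightarrow> residue_class \<pi> x = \<zero>\<^bsub>residue_field\<^esub> \<longleftrightarrow> \<pi> divides\<^bsub>quad_int_ring d\<^esub> x"
  using residue_class_eq[of x 0] h.hom_zero by simp

lemma residue_class_power: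
  "x \<in> \<O> \<Longrightarrow> residue_class \<pi> (x ^ k) = residue_class \<pi> x [^]\<^bsub>residue_field\<^esub> k"
  using h.hom_nat_pow[of x k] by simp

lemma nonresidue_exists:
  assumes N: "(cmod \<pi>)\<^sup>2 = of_nat N" and k: "k > 0" "gcd k (N - 1) > 1"
  shows "\<exists>\<omega>. power_nonresidue d k \<pi> \<omega>"
proof -
  have "order residue_field = N"
    using index_eq_norm[OF pi_ord pi_nonzero N]
    by (simp add: order_def carrier_residue_field index_def)
  \<comment> \<open>Positive cardinality is what shows the residue field to be finite.\<close>
  moreover have "N > 0"
    using N pi_nonzero by (auto intro: gr0I)
  ultimately have "\<exists>c \<in> carrier residue_field - {\<zero>\<^bsub>residue_field\<^esub>}.
      \<forall>y \<in> carrier residue_field. y [^]\<^bsub>residue_field\<^esub> k \<noteq> c"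
    using k F.field_axioms
    by (intro finite_field_power_not_surj) (auto simp: order_def intro: card_ge_0_finite)
  then obtain \<omega> where \<omega>: "\<omega> \<in> \<O>" "residue_class \<pi> \<omega> \<noteq> \<zero>\<^bsub>residue_field\<^esub>"
    "\<And>x. x \<in> \<O> \<Longrightarrow> residue_class \<pi> x [^]\<^bsub>residue_field\<^esub> k \<noteq> residue_class \<pi> \<omega>"
    unfolding carrier_residue_field by blast
  have "power_nonresidue d k \<pi> \<omega>"
    using \<omega> by (auto simp: power_nonresidue_def power_residue_def quad_cong_def
        residue_class_eq_zero residue_class_eq[symmetric] residue_class_power)
  then show ?thesis ..
qed

lemma inverse_mod:
  assumes "y \<in> \<O>" "\<not> \<pi> divides\<^bsub>quad_int_ring d\<^esub> y"
  obtains z where "z \<in> \<O>" "\<pi> divides\<^bsub>quad_int_ring d\<^esub> (y * z - 1)"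
proof -
  have "residue_class \<pi> y \<in> Units residue_field"
    using assms residue_class_eq_zero[OF assms(1)] carrier_residue_field
    by (auto simp: F.field_Units)
  from F.Units_r_inv_ex[OF this] obtain z where z: "z \<in> \<O>"
    "residue_class \<pi> y \<otimes>\<^bsub>residue_field\<^esub> residue_class \<pi> z = \<one>\<^bsub>residue_field\<^esub>"
    unfolding carrier_residue_field by auto
  then have "residue_class \<pi> (y * z) = residue_class \<pi> 1"
    using h.hom_mult[of y z] h.hom_one assms(1) by simp
  then show ?thesis
    using that z(1) assms(1) residue_class_eq by simp
qed

lemma divides_add:
  "\<pi> divides\<^bsub>quad_int_ring d\<^esub> x \<Longrightarrow> \<pi> divides\<^bsub>quad_int_ring d\<^esub> y \<Longrightarrow>
    \<pi> divides\<^bsub>quad_int_ring d\<^esub> (x + y)"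
  unfolding divides_iff by (metis add_ord distrib_left)

lemma divides_mult:
  "\<pi> divides\<^bsub>quad_int_ring d\<^esub> x \<Longrightarrow> a \<in> \<O> \<Longrightarrow> \<pi> divides\<^bsub>quad_int_ring d\<^esub> (a * x)"
  unfolding divides_iff by (metis mult.left_commute mult_ord)

lemma divides_power:
  assumes "\<pi> divides\<^bsub>quad_int_ring d\<^esub> x" "x \<in> \<O>" "k > 0"
  shows "\<pi> divides\<^bsub>quad_int_ring d\<^esub> (x ^ k)"
  using divides_mult[OF assms(1), of "x ^ (k - 1)"] assms(2,3)
  by (simp add: power_Suc2[symmetric])

lemma divides_diff:
  assumes "\<pi> divides\<^bsub>quad_int_ring d\<^esub> x" "\<pi> divides\<^bsub>quad_int_ring d\<^esub> y"
  shows "\<pi> divides\<^bsub>quad_int_ring d\<^esub> (x - y)"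
  using divides_add[OF assms(1) divides_mult[OF assms(2), of "-1"]] by simp

section \<open>Power non-residues and the bound for the least one\<close>

lemma nonresidue_iff:
  "power_nonresidue d k \<pi> x \<longleftrightarrow>
    x \<in> \<O> \<and> \<not> \<pi> divides\<^bsub>quad_int_ring d\<^esub> x \<and>
    (\<forall>y\<in>\<O>. \<not> \<pi> divides\<^bsub>quad_int_ring d\<^esub> (y ^ k - x))"
  by (auto simp: power_nonresidue_def power_residue_def quad_cong_def)

lemma nonresidue_cong:
  assumes "power_nonresidue d k \<pi> x" "y \<in> \<O>" "\<pi> divides\<^bsub>quad_int_ring d\<^esub> (x - y)"
  shows "power_nonresidue d k \<pi> y"
  unfolding nonresidue_iff
proof (intro conjI ballI notI)
  show "y \<in> \<O>" by fact
next
  assume "\<pi> divides\<^bsub>quad_int_ring d\<^esub> y"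
  then show False
    using divides_add[OF assms(3), of y] assms(1) by (simp add: nonresidue_iff)
next
  fix z assume "z \<in> \<O>" "\<pi> divides\<^bsub>quad_int_ring d\<^esub> (z ^ k - y)"
  then show False
    using divides_diff[OF _ assms(3), of "z ^ k - y"] assms(1) by (simp add: nonresidue_iff)
qed

text \<open>Modulo \<open>\<pi>\<close>, \<open>\<omega> * q\<close> is congruent to
  \<open>- r\<close>, a \<open>k\<close>th power \<open>x ^ k\<close>. If \<open>q\<close> were
  \<open>y ^ k\<close> and \<open>z\<close> an inverse of \<open>y\<close>, then
  \<open>\<omega>\<close> would be congruent to \<open>(x * z) ^ k\<close>.\<close>

lemma cofactor_nonresidue:
  assumes k: "k > 0" and \<omega>: "power_nonresidue d k \<pi> \<omega>"
    and q: "q \<in> \<O>" and r: "r \<in> \<O>" "\<not> \<pi> divides\<^bsub>quad_int_ring d\<^esub> r"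
    and eq: "\<pi> = \<omega> * q + r" and res: "\<not> power_nonresidue d k \<pi> (- r)"
  shows "power_nonresidue d k \<pi> q"
proof -
  let ?dvd = "\<lambda>x. \<pi> divides\<^bsub>quad_int_ring d\<^esub> x"
  have \<omega>': "\<omega> \<in> \<O>" "\<And>x. x \<in> \<O> \<Longrightarrow> \<not> ?dvd (x ^ k - \<omega>)"
    using \<omega> by (auto simp: nonresidue_iff)
  have dvd_pi: "?dvd \<pi>"
    unfolding divides_iff using one_ord by (metis mult.right_neutral)
  have q_not: "\<not> ?dvd q"
  proof
    assume "?dvd q"
    then have "?dvd (\<pi> - \<omega> * q)"
      using divides_diff[OF dvd_pi divides_mult] \<omega>'(1) by blast
    then show False
      using r(2) eq by simp
  qed
  have "\<not> ?dvd (- r)"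
    using divides_mult[of "- r" "-1"] r(2) by auto
  then obtain x where x: "x \<in> \<O>" "?dvd (x ^ k + r)"
    using res r(1) by (auto simp: nonresidue_iff)
  have False if y: "y \<in> \<O>" "?dvd (y ^ k - q)" for y
  proof -
    have "\<not> ?dvd y"
    proof
      assume "?dvd y"
      then have "?dvd (y ^ k - (y ^ k - q))"
        using divides_diff divides_power y k by blast
      then show False
        using q_not by simp
    qed
    then obtain z where z: "z \<in> \<O>" "?dvd (y * z - 1)"
      using inverse_mod[OF y(1)] by blast
    \<comment> \<open>The geometric sum times \<open>y * z - 1\<close> is
      \<open>(y * z) ^ k - 1\<close>, so \<open>z ^ k\<close> inverts \<open>y ^ k\<close>.\<close>
    have "?dvd ((\<Sum>i<k. (y * z) ^ i) * (y * z - 1))"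
      using y(1) z(1) by (intro divides_mult[OF z(2)] sum_ord power_ord mult_ord)
    then have "?dvd ((y * z) ^ k - 1)"
      by (simp add: power_diff_1_eq mult.commute)
    \<comment> \<open>The first two terms give \<open>(x * z) ^ k - \<omega> * q * z ^ k\<close>,
      the bracket gives \<open>\<omega> - \<omega> * q * z ^ k\<close>; the terms in
      \<open>q\<close> cancel.\<close>
    then have "?dvd (z ^ k * (x ^ k + r) - z ^ k * \<pi>
        - (\<omega> * z ^ k * (y ^ k - q) - \<omega> * ((y * z) ^ k - 1)))"
      using x y z(1) \<omega>'(1) dvd_pi
      by (intro divides_diff[OF divides_diff divides_diff] divides_mult mult_ord power_ord)
    also have "z ^ k * (x ^ k + r) - z ^ k * \<pi>
        - (\<omega> * z ^ k * (y ^ k - q) - \<omega> * ((y * z) ^ k - 1)) = (x * z) ^ k - \<omega>"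
      unfolding eq by (simp add: algebra_simps power_mult_distrib)
    finally show False
      using \<omega>'(2) x(1) z(1) by blast
  qed
  then show ?thesis
    using q q_not by (auto simp: nonresidue_iff)
qed

text \<open>The inverse is a nonzero element of the order, so its modulus is at least 1.\<close>

lemma unit_cmod_le:
  assumes "u \<in> Units (quad_int_ring d)"
  shows "cmod u \<le> 1"
proof -
  obtain v where v: "v \<in> \<O>" "u * v = 1"
    using assms by (auto simp: Units_def)
  then have "cmod v \<ge> 1"
    using ord_zero_if_cmod_less_1[OF v(1)] by fastforce
  moreover have "cmod u * cmod v = 1"
    using v(2) by (metis norm_mult norm_one)
  ultimately show ?thesis
    using mult_left_mono[of 1 "cmod v" "cmod u"] by simp
qed

theorem small_nonresidue:
  assumes N: "(cmod \<pi>)\<^sup>2 = of_nat N" and k: "k > 0" "gcd k (N - 1) > 1"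
  shows "\<exists>\<omega>. power_nonresidue d k \<pi> \<omega> \<and> cmod \<omega> < sqrt (cmod \<pi>) + 0.65"
proof -
  let ?dvd = "\<lambda>x. \<pi> divides\<^bsub>quad_int_ring d\<^esub> x"
  obtain \<omega> where \<omega>: "power_nonresidue d k \<pi> \<omega>"
    and least: "\<And>x. power_nonresidue d k \<pi> x \<Longrightarrow> nat \<lfloor>(cmod \<omega>)\<^sup>2\<rfloor> \<le> nat \<lfloor>(cmod x)\<^sup>2\<rfloor>"
    using nonresidue_exists[OF N k]
      ex_has_least_nat[of "power_nonresidue d k \<pi>" _ "\<lambda>z. nat \<lfloor>(cmod z)\<^sup>2\<rfloor>"] by metis
  have \<omega>_ord: "\<omega> \<in> \<O>" and \<omega>_not: "\<not> ?dvd \<omega>"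
    using \<omega> by (auto simp: nonresidue_iff)
  have minimal: "cmod \<omega> \<le> cmod x" if "power_nonresidue d k \<pi> x" for x
  proof (rule ccontr)
    have "x \<in> \<O>"
      using that by (simp add: nonresidue_iff)
    moreover assume "\<not> cmod \<omega> \<le> cmod x"
    ultimately show False
      using norm_less[of x \<omega>] \<omega>_ord least[OF that] by (metis not_le)
  qed
  have \<omega>_nonzero: "\<omega> \<noteq> 0"
    using \<omega>_not unfolding divides_iff by (metis mult_zero_right zero_ord)
  have pi_ge_1: "cmod \<pi> \<ge> 1"
    using ord_zero_if_cmod_less_1[OF pi_ord] pi_nonzero by fastforce
  \<comment> \<open>The remainder of \<open>\<omega>\<close> on division by \<open>\<pi>\<close> is
    again a non-residue, so minimality applies to it.\<close>
  have \<omega>_less: "cmod \<omega> < cmod \<pi>"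
  proof -
    obtain q r where qr: "q \<in> \<O>" "r \<in> \<O>" "\<omega> = \<pi> * q + r" "cmod r < cmod \<pi>"
      using ord_division[OF pi_nonzero \<omega>_ord pi_ord] .
    then have "?dvd (\<omega> - r)"
      by (auto simp: divides_iff)
    then have "power_nonresidue d k \<pi> r"
      using nonresidue_cong[OF \<omega>] qr(2) by blast
    then show ?thesis
      using minimal qr(4) by fastforce
  qed
  obtain q r where qr: "q \<in> \<O>" "r \<in> \<O>" "\<pi> = \<omega> * q + r" "cmod r < cmod \<omega>"
    using ord_division[OF \<omega>_nonzero pi_ord \<omega>_ord] .
  have "cmod \<omega> < sqrt (cmod \<pi>) + 13/20"
  proof (cases "?dvd r")
    \<comment> \<open>Here \<open>|r| < |\<omega>| < |\<pi>|\<close> forces \<open>r = 0\<close>, so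
      irreducibility makes \<open>\<omega>\<close> or \<open>q\<close> a unit. A unit
      \<open>\<omega>\<close> has modulus at most 1; a unit \<open>q\<close> would give
      \<open>|\<pi>| \<le> |\<omega>|\<close>.\<close>
    case True
    then obtain y where y: "y \<in> \<O>" "r = \<pi> * y"
      by (auto simp: divides_iff)
    then have "cmod \<pi> * cmod y < cmod \<pi> * 1"
      using qr(4) \<omega>_less by (simp add: norm_mult)
    then have "cmod y < 1"
      by (simp add: pi_nonzero)
    then have "\<pi> = \<omega> * q"
      using ord_zero_if_cmod_less_1[OF y(1)] y(2) qr(3) by simp
    then have "\<omega> \<in> Units (quad_int_ring d) \<or> q \<in> Units (quad_int_ring d)"
      using O.ring_irreducibleE(5)[OF _ pi_irreducible, of \<omega> q] \<omega>_ord qr(1) pi_ord by simp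
    then show ?thesis
    proof
      assume "\<omega> \<in> Units (quad_int_ring d)"
      then have "cmod \<omega> \<le> 1"
        by (rule unit_cmod_le)
      moreover have "sqrt (cmod \<pi>) \<ge> 1"
        using pi_ge_1 by simp
      ultimately show ?thesis
        by linarith
    next
      assume "q \<in> Units (quad_int_ring d)"
      then have "cmod \<omega> * cmod q \<le> cmod \<omega> * 1"
        by (intro mult_left_mono unit_cmod_le) simp_all
      then show ?thesis
        using \<open>\<pi> = \<omega> * q\<close> \<omega>_less by (simp add: norm_mult)
    qed
  next
    case False
    \<comment> \<open>\<open>- r\<close> is shorter than the least non-residue.\<close>
    have "\<not> power_nonresidue d k \<pi> (- r)"
      using minimal[of "- r"] qr(4) by auto
    then have "power_nonresidue d k \<pi> q"
      using cofactor_nonresidue[OF k(1) \<omega> qr(1,2) False qr(3)] by blast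
    then have "cmod \<omega> * cmod \<omega> \<le> cmod \<omega> * cmod q"
      by (intro mult_left_mono minimal) simp_all
    also have "\<dots> = cmod (\<pi> - r)"
      using qr(3) by (simp add: norm_mult)
    also have "\<dots> \<le> cmod \<pi> + cmod r"
      by (rule norm_triangle_ineq4)
    also have "\<dots> < cmod \<pi> + cmod \<omega>"
      using qr(4) by simp
    finally have bound: "cmod \<omega> * cmod \<omega> < cmod \<pi> + cmod \<omega>" .
    define s where "s = sqrt (cmod \<pi>)"
    have s: "s \<ge> 1" "cmod \<pi> = s * s"
      using pi_ge_1 by (simp_all add: s_def)
    show ?thesis
    proof (rule ccontr)
      assume "\<not> ?thesis"
      then have ge: "cmod \<omega> \<ge> s + 13/20"
        by (simp add: s_def)
      \<comment> \<open>The left side is \<open>s^2 + 3/10 * s - 91/400\<close>, which exceeds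
        \<open>s^2\<close> for \<open>s \<ge> 1\<close>, while \<open>bound\<close> puts the right
        side below \<open>s^2\<close>. The constant 13/20 lies just above (sqrt 5 - 1)/2, the
        positive root of c^2 + c = 1, which is the threshold at \<open>s = 1\<close>.\<close>
      then have "(s + 13/20) * (s - 7/20) \<le> cmod \<omega> * (cmod \<omega> - 1)"
        using s(1) by (intro mult_mono) simp_all
      then show False
        using bound s by (simp add: algebra_simps)
    qed
  qed
  then have "cmod \<omega> < sqrt (cmod \<pi>) + 0.65"
    by simp
  then show ?thesis
    using \<omega> by blast
qed

end

section \<open>The five fields\<close>

text \<open>The usual integral bases: \<open>\<theta>\<close> is the square root of \<open>d\<close>
  for -1 and -2, and half of 1 plus that root when \<open>d\<close> is 1 modulo 4. The squared
  imaginary part is \<open>-d\<close> or \<open>-d/4\<close>, at most 11/4.\<close>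

lemma euclidean_quad_order:
  assumes "d \<in> {-1, -2, -3, -7, -11}"
  obtains \<theta> t n where "euclidean_quad d \<theta> t n"
proof (cases "d \<in> {-1, -2}")
  case True
  have s: "csqrt (of_int d) = \<i> * sqrt (- of_int d)"
    using True by (auto simp: complex_eq_iff)
  have "csqrt (of_int d) = of_rat 0 + of_rat 1 * csqrt (of_int d)"
    by simp
  then have "csqrt (of_int d) \<in> quad_field d"
    unfolding quad_field_def by blast
  moreover have "\<exists>a b :: int. csqrt (of_int d) = of_int a + of_int b * csqrt (of_int d)"
    by (rule exI[of _ 0], rule exI[of _ 1]) simp
  moreover have "(cmod (csqrt (of_int d)))\<^sup>2 = of_int (- d)"
    using True by (auto simp: cmod_power2)
  ultimately have "euclidean_quad d (csqrt (of_int d)) 0 (- d)"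
    using True by unfold_locales (assumption | auto simp: s)+
  then show ?thesis
    using that by blast
next
  case False
  have s: "csqrt (of_int d) = \<i> * sqrt (- of_int d)"
    using assms by (auto simp: complex_eq_iff)
  let ?th = "(1 + csqrt (of_int d)) / 2"
  have "?th = of_rat (1/2) + of_rat (1/2) * csqrt (of_int d)"
    by (simp add: of_rat_divide field_simps)
  then have "?th \<in> quad_field d"
    unfolding quad_field_def by blast
  moreover have "\<exists>a b :: int. csqrt (of_int d) = of_int a + of_int b * ?th"
    by (rule exI[of _ "-1"], rule exI[of _ 2]) (simp add: field_simps)
  \<comment> \<open>The norm of \<open>?th\<close> is \<open>(1 - d) / 4\<close>; the division is
    exact for -3, -7 and -11.\<close>
  ultimately have "euclidean_quad d ?th 1 ((1 - d) div 4)"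
    using assms False by unfold_locales (assumption | auto simp: s cmod_power2 power_divide)+
  then show ?thesis
    using that by blast
qed

theorem theorem2:
  fixes d :: int and \<pi> :: complex and k :: nat
  assumes "d \<in> {-1, -2, -3, -7, -11}"
    and "\<pi> \<in> carrier (quad_int_ring d)"
    and "ring_irreducible\<^bsub>quad_int_ring d\<^esub> \<pi>"
    and "k > 0"
    and "gcd (int k) (quad_norm \<pi> - 1) > 1"
  shows "\<exists>\<omega> \<in> carrier (quad_int_ring d).
           power_nonresidue d k \<pi> \<omega> \<and> cmod \<omega> < sqrt (cmod \<pi>) + 0.65"
proof -
  obtain \<theta> t n where "euclidean_quad d \<theta> t n"
    using euclidean_quad_order[OF assms(1)] .
  then interpret euclidean_quad d \<theta> t n .
  interpret euclidean_quad_prime d \<theta> t n \<pi>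
    using assms(2,3) by unfold_locales simp_all
  obtain N :: nat where N: "(cmod \<pi>)\<^sup>2 = of_nat N"
    using norm_ord[OF pi_ord] .
  have "\<pi> * cnj \<pi> = of_int (int N)"
    using N by (simp add: complex_norm_square[symmetric] del: of_real_power)
  then have "quad_norm \<pi> = int N"
    unfolding quad_norm_def by (intro the_equality) (metis of_int_eq_iff)+
  \<comment> \<open>This makes the truncated subtraction in \<open>N - 1\<close> agree with the
    integer one in the hypothesis on the gcd.\<close>
  moreover have "N > 0"
    using N pi_nonzero by (auto intro: gr0I)
  ultimately have "int (gcd k (N - 1)) > 1"
    using assms(5) by (simp add: of_nat_diff flip: gcd_int_int_eq)
  then show ?thesis
    using small_nonresidue[OF N assms(4)] by (auto simp: power_nonresidue_def)
qed

end
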